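(* For all non-negative integers $n, j, r$ with $r\geq 2$, $$b'_{j,r}(n)=T_{j+1,r}(n)-T_{j,r}(n),$$ where $$b'_{j,r}(n)=\sum_{\lambda\in \mathcal{D}_{j,r}(n)}\bar{\ell}(\lambda)-\sum_{\lambda\in \mathcal{O}_{j,r}(n)}\bar{\ell}(\lambda)$$ and, for each $i\geq 0$, $T_{i,r}(n)$ is the number of different parts with multiplicity between $r+1$ and $2r-1$ (inclusive) in all partitions in $\mathcal{D}_{i,r}(n)$.
   Context: A partition $\lambda$ of a non-negative integer $n$ is a non-increasing finite sequence of positive integers (its parts) with sum $n$; the empty partition is the only partition of $0$. $\bar{\ell}(\lambda)$ denotes the number of different parts (distinct part values) of $\lambda$. For integers $j\ge 0$, $r\ge 2$, $n \ge 0$: - $\mathcal{O}_{j,r}(n)$ is the set of partitions of $n$ with exactly $j$ different parts divisible by $r$. Here different means distinct part values; these parts may be repeated. - $\mathcal{D}_{j,r}(n)$ is the set of partitions of $n$ in which exactly $j$ different parts are repeated at least $r$ times (i.e. have multiplicity at least $r$), all other parts appearing at most $r-1$ times. - $T_{j,r}(n)$ is the sum, over all $\lambda\in\mathcal{D}_{j,r}(n)$, of the number of distinct part values of $\lambda$ whose multiplicity $s$ in $\lambda$ satisfies $r+1\leq s\leq 2r-1$. Differences are taken in $\mathbb{Z}$ (they may be negative). *)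

theory Defs
  imports Main "HOL-Library.Multiset"
begin

(* A non-increasing finite sequence is determined by the multiset of its terms,
   so a partition is represented by the multiset of its parts. *)
definition partitions :: "nat \<Rightarrow> nat multiset set" where
  "partitions n = {p. (\<forall>k\<in>#p. 0 < k) \<and> sum_mset p = n}"

definition num_diff_parts :: "nat multiset \<Rightarrow> nat" where
  "num_diff_parts p = card (set_mset p)"

definition O_set :: "nat \<Rightarrow> nat \<Rightarrow> nat \<Rightarrow> nat multiset set" where
  "O_set j r n = {p \<in> partitions n. card {k \<in> set_mset p. r dvd k} = j}"

definition D_set :: "nat \<Rightarrow> nat \<Rightarrow> nat \<Rightarrow> nat multiset set" where
  "D_set j r n = {p \<in> partitions n. card {k \<in> set_mset p. r \<le> count p k} = j}"

definition T_num :: "nat \<Rightarrow> nat \<Rightarrow> nat \<Rightarrow> nat" where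
  "T_num j r n =
     (\<Sum>p\<in>D_set j r n. card {k \<in> set_mset p. r + 1 \<le> count p k \<and> count p k \<le> 2 * r - 1})"

definition b' :: "nat \<Rightarrow> nat \<Rightarrow> nat \<Rightarrow> int" where
  "b' j r n =
     int (\<Sum>p\<in>D_set j r n. num_diff_parts p) - int (\<Sum>p\<in>O_set j r n. num_diff_parts p)"

(* The sums above range over finite sets, so none of them is 0 by convention. *)
lemma finite_partitions: "finite (partitions n)"
proof -
  have "partitions n \<subseteq> mset ` {xs. set xs \<subseteq> {..n} \<and> length xs \<le> n}"
  proof
    fix p assume "p \<in> partitions n"
    then have pos: "\<forall>k\<in>#p. 0 < k" and sum: "sum_mset p = n"
      by (auto simp: partitions_def)
    have "k \<le> n" if "k \<in># p" for k
      using sum that by (auto dest!: multi_member_split)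
    moreover have "size p \<le> sum_mset p"
      using pos by (induction p) auto
    moreover obtain xs where "mset xs = p" using ex_mset by blast
    ultimately show "p \<in> mset ` {xs. set xs \<subseteq> {..n} \<and> length xs \<le> n}"
      using sum by (intro image_eqI[of _ _ xs]) auto
  qed
  then show ?thesis
    by (rule finite_subset) (intro finite_imageI finite_lists_length_le finite_atMost)
qed

lemma finite_O_set: "finite (O_set j r n)"
  using finite_partitions[of n] by (simp add: O_set_def)

lemma finite_D_set: "finite (D_set j r n)"
  using finite_partitions[of n] by (simp add: D_set_def)

end

theory Submission
  imports Defs "HOL-Computational_Algebra.Formal_Power_Series"
    "HOL-Computational_Algebra.Polynomial"
begin

text \<open>
  The proof compares generating functions. Let \<open>Z\<close> count the part values whose multiplicity is
  at least \<open>r\<close> (for \<open>D_set\<close>) or that are divisible by \<open>r\<close> (for \<open>O_set\<close>), and let \<open>X\<close> count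
  size. The factor of a part value \<open>k\<close> on the \<open>D\<close> side is
  \<open>(1 + (Z - 1) X^(r k)) / (1 - X^k)\<close>; on the \<open>O\<close> side it is \<open>1 / (1 - X^k)\<close> if \<open>r\<close> does not
  divide \<open>k\<close>, and \<open>(1 + (Z - 1) X^k) / (1 - X^k)\<close> otherwise. Since the multiples of \<open>r\<close> are the
  numbers \<open>r k\<close>, both products equal the same series \<open>F\<close>.

  A statistic that counts part values of some kind is a sum over \<open>k\<close> of indicators that depend on
  the multiplicity of \<open>k\<close> alone. Summing it over all partitions therefore replaces one factor of
  the product by its marked version, and adds up over the choice of that factor
  (\<open>sum_marked_multiplicities\<close>). With \<open>y k = 1 + (Z - 1) X^(r k)\<close> the three totals are
    \<^item> different parts over \<open>D\<close>: the sum over \<open>k\<close> of \<open>(F / y k) (X^k + (Z - 1) X^(r k))\<close>;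
    \<^item> different parts over \<open>O\<close>: the sum over \<open>k\<close> not divisible by \<open>r\<close> of \<open>F X^k\<close>, plus the sum over
      all \<open>k\<close> of \<open>(F / y k) Z X^(r k)\<close>;
    \<^item> multiplicities in \<open>{r + 1..2 r - 1}\<close> over \<open>D\<close>: the sum over \<open>k\<close> of
      \<open>(F / y k) Z X^(r k) (X^k - X^(r k))\<close>.

  Writing the sum of \<open>F X^k\<close> over the \<open>k\<close> not divisible by \<open>r\<close> as the sum over all \<open>k\<close> of
  \<open>F (X^k - X^(r k))\<close>, one sees term by term that \<open>Z\<close> times the difference of the first two totals
  is \<open>1 - Z\<close> times the third (\<open>marked_products_identity\<close>). The theorem is the coefficient of
  \<open>Z^(j + 1) X^n\<close> in this identity.
\<close>

section \<open>Partitions with prescribed part values and their generating functions\<close>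

definition partitions_in :: "nat set \<Rightarrow> nat \<Rightarrow> nat multiset set" where
  "partitions_in K n = {p. set_mset p \<subseteq> K \<and> sum_mset p = n}"

text \<open>The series \<open>\<Sum>m. a m * X ^ (k * m)\<close>, that is, the factor contributed by the part value \<open>k\<close> when
  its multiplicity \<open>m\<close> has weight \<open>a m\<close>.\<close>

definition mult_gf :: "nat \<Rightarrow> (nat \<Rightarrow> 'a) \<Rightarrow> 'a::zero fps" where
  "mult_gf k a = Abs_fps (\<lambda>i. if k dvd i then a (i div k) else 0)"

lemma partitions_in_eq_partitions:
  assumes "{1..n} \<subseteq> K" "0 \<notin> K"
  shows "partitions_in K n = partitions n"
proof -
  have "k \<le> sum_mset p" if "k \<in># p" for k and p :: "nat multiset"
    using that by (auto dest!: multi_member_split)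
  then show ?thesis
    using assms by (fastforce simp: partitions_in_def partitions_def Suc_le_eq intro: gr0I)
qed

lemma finite_partitions_in:
  assumes "0 \<notin> K"
  shows "finite (partitions_in K n)"
proof (rule finite_subset)
  show "partitions_in K n \<subseteq> partitions n"
    using assms by (auto simp: partitions_in_def partitions_def intro!: gr0I)
qed (rule finite_partitions)

lemma mult_gf_mult_nth:
  fixes a :: "nat \<Rightarrow> 'a::comm_ring_1"
  assumes "0 < k"
  shows "fps_nth (mult_gf k a * G) n = (\<Sum>m | m * k \<le> n. a m * fps_nth G (n - m * k))"
proof -
  have "fps_nth (mult_gf k a * G) n =
      (\<Sum>i\<in>{0..n}. if k dvd i then a (i div k) * fps_nth G (n - i) else 0)"
    by (auto simp: fps_mult_nth mult_gf_def intro!: sum.cong)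
  also have "\<dots> = (\<Sum>i\<in>{i\<in>{0..n}. k dvd i}. a (i div k) * fps_nth G (n - i))"
    by (rule sum.inter_filter[symmetric]) simp
  also have "\<dots> = (\<Sum>m | m * k \<le> n. a m * fps_nth G (n - m * k))"
    using assms
    by (intro sum.reindex_bij_witness[of _ "\<lambda>m. m * k" "\<lambda>i. i div k"]) auto
  finally show ?thesis .
qed

text \<open>The Euler product for partitions with arbitrary multiplicative weights. A partition with parts
  in \<open>insert k K\<close> is a multiplicity of \<open>k\<close> together with a partition with parts in \<open>K\<close> of what
  remains, and this is the convolution with the factor of \<open>k\<close>.\<close>

lemma sum_prod_multiplicities:
  fixes g :: "nat \<Rightarrow> nat \<Rightarrow> 'a::comm_ring_1"
  assumes "finite K" "0 \<notin> K"
  shows "(\<Sum>p\<in>partitions_in K n. \<Prod>k\<in>K. g k (count p k)) = fps_nth (\<Prod>k\<in>K. mult_gf k (g k)) n"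
  using assms
proof (induction K arbitrary: n rule: finite_induct)
  case empty
  have "partitions_in {} n = (if n = 0 then {{#}} else {})"
    by (auto simp: partitions_in_def)
  then show ?case by simp
next
  case (insert k K)
  then have k: "0 < k" and K: "0 \<notin> K" by auto
  let ?W = "\<lambda>p. \<Prod>i\<in>K. g i (count p i)"
  have cnt: "count p k = 0" if "set_mset p \<subseteq> K" for p
    using that insert.hyps by (auto simp: count_eq_zero_iff)
  have fin: "finite {m. m * k \<le> n}"
  proof (rule finite_subset)
    show "{m. m * k \<le> n} \<subseteq> {..n}"
    proof
      fix m assume "m \<in> {m. m * k \<le> n}"
      then show "m \<in> {..n}" using k le_trans[of m "m * k" n] by simp
    qed
  qed simp
  have "(\<Sum>p\<in>partitions_in (insert k K) n. \<Prod>i\<in>insert k K. g i (count p i)) =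
      (\<Sum>(m, p)\<in>(SIGMA m:{m. m * k \<le> n}. partitions_in K (n - m * k)). g k m * ?W p)"
  proof (rule sum.reindex_bij_witness[of _ "\<lambda>(m, p). p + replicate_mset m k"
        "\<lambda>p. (count p k, filter_mset (\<lambda>x. x \<noteq> k) p)"], goal_cases)
    case (1 p)
    show ?case by (auto intro!: multiset_eqI)
  next
    case (2 p)
    have eq: "filter_mset (\<lambda>x. x \<noteq> k) p + replicate_mset (count p k) k = p"
      by (auto intro!: multiset_eqI)
    have "sum_mset (filter_mset (\<lambda>x. x \<noteq> k) p) + count p k * k = n"
      using 2 arg_cong[OF eq, of sum_mset] by (simp add: partitions_in_def)
    then show ?case using 2 by (auto simp: partitions_in_def)
  next
    case (3 q)
    then show ?case
      using cnt insert.hyps by (auto simp: partitions_in_def count_eq_zero_iff intro!: multiset_eqI)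
  next
    case (4 q)
    then show ?case by (auto simp: partitions_in_def split: if_splits)
  next
    case (5 p)
    have "?W (filter_mset (\<lambda>x. x \<noteq> k) p) = ?W p"
      using insert.hyps by (intro prod.cong) auto
    then show ?case using insert.hyps by simp
  qed
  also have "\<dots> = (\<Sum>m | m * k \<le> n. g k m * (\<Sum>p\<in>partitions_in K (n - m * k). ?W p))"
    using fin K by (subst sum.Sigma[symmetric]) (auto simp: sum_distrib_left finite_partitions_in)
  also have "\<dots> = fps_nth (mult_gf k (g k) * (\<Prod>i\<in>K. mult_gf i (g i))) n"
    using k K by (simp add: mult_gf_mult_nth insert.IH)
  finally show ?case using insert.hyps by simp
qed

text \<open>The Leibniz rule for the Euler product: an additive statistic with local contributions \<open>c k\<close>
  changes the weight of one part value at a time. The series \<open>E k\<close> is a common divisor of the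
  plain and the marked factors (the geometric series in the application), so that only the
  polynomial cofactors \<open>u\<close> and \<open>v\<close> have to be compared later.\<close>

lemma sum_marked_multiplicities:
  fixes w c :: "nat \<Rightarrow> nat \<Rightarrow> 'a::comm_ring_1"
  assumes K: "finite K" "0 \<notin> K"
    and w: "\<And>k. k \<in> K \<Longrightarrow> mult_gf k (w k) = u k * E k"
    and cw: "\<And>k. k \<in> K \<Longrightarrow> mult_gf k (\<lambda>m. c k m * w k m) = v k * E k"
  shows "(\<Sum>p\<in>partitions_in K n. (\<Sum>k\<in>K. c k (count p k)) * (\<Prod>k\<in>K. w k (count p k))) =
    fps_nth ((\<Sum>k\<in>K. v k * (\<Prod>i\<in>K - {k}. u i)) * (\<Prod>k\<in>K. E k)) n"
proof -
  have "(\<Sum>k\<in>K. c k (count p k)) * (\<Prod>k\<in>K. w k (count p k)) =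
      (\<Sum>k\<in>K. \<Prod>i\<in>K. (if i = k then (\<lambda>m. c k m * w k m) else w i) (count p i))" for p
    unfolding sum_distrib_right
  proof (rule sum.cong[OF refl])
    fix k assume "k \<in> K"
    then show "c k (count p k) * (\<Prod>k\<in>K. w k (count p k)) =
        (\<Prod>i\<in>K. (if i = k then (\<lambda>m. c k m * w k m) else w i) (count p i))"
      using K by (simp add: prod.remove[of K k] mult.assoc)
  qed
  then have "(\<Sum>p\<in>partitions_in K n. (\<Sum>k\<in>K. c k (count p k)) * (\<Prod>k\<in>K. w k (count p k))) =
      (\<Sum>k\<in>K. \<Sum>p\<in>partitions_in K n.
         \<Prod>i\<in>K. (if i = k then (\<lambda>m. c k m * w k m) else w i) (count p i))"
    by (simp only:) (rule sum.swap)
  also have "\<dots> = (\<Sum>k\<in>K. fps_nth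
      (\<Prod>i\<in>K. mult_gf i (if i = k then (\<lambda>m. c k m * w k m) else w i)) n)"
    by (intro sum.cong refl
        sum_prod_multiplicities[OF K, of "\<lambda>i. if i = k then (\<lambda>m. c k m * w k m) else w i" for k])
  also have "\<dots> = (\<Sum>k\<in>K. fps_nth (v k * (\<Prod>i\<in>K - {k}. u i) * (\<Prod>k\<in>K. E k)) n)"
  proof (rule sum.cong[OF refl])
    fix k assume k: "k \<in> K"
    have "(\<Prod>i\<in>K. mult_gf i (if i = k then (\<lambda>m. c k m * w k m) else w i)) =
        (v k * E k) * (\<Prod>i\<in>K - {k}. u i * E i)"
      using K k by (simp add: prod.remove[of K k] w cw)
    also have "\<dots> = v k * (\<Prod>i\<in>K - {k}. u i) * (\<Prod>k\<in>K. E k)"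
      using K k by (simp add: prod.remove[of K k E] prod.distrib mult_ac)
    finally show "fps_nth (\<Prod>i\<in>K. mult_gf i (if i = k then (\<lambda>m. c k m * w k m) else w i)) n =
        fps_nth (v k * (\<Prod>i\<in>K - {k}. u i) * (\<Prod>k\<in>K. E k)) n" by simp
  qed
  also have "\<dots> = fps_nth ((\<Sum>k\<in>K. v k * (\<Prod>i\<in>K - {k}. u i)) * (\<Prod>k\<in>K. E k)) n"
    by (simp add: sum_distrib_right fps_sum_nth)
  finally show ?thesis .
qed

text \<open>Every weight below is a linear combination of indicators \<open>s \<le> m\<close>. Their series are monomial
  multiples of the geometric series, which makes the cofactors computable by linearity.\<close>

abbreviation geom :: "nat \<Rightarrow> 'a::comm_ring_1 fps" where
  "geom k \<equiv> mult_gf k (\<lambda>_. 1)"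

lemma mult_gf_tail:
  assumes "0 < k"
  shows "mult_gf k (\<lambda>m. of_bool (s \<le> m)) = fps_X ^ (s * k) * (geom k :: 'a::comm_ring_1 fps)"
proof (rule fps_ext)
  fix i
  show "fps_nth (mult_gf k (\<lambda>m. of_bool (s \<le> m))) i =
      fps_nth (fps_X ^ (s * k) * (geom k :: 'a fps)) i"
  proof (cases "k dvd i")
    case True
    then obtain m where i: "i = m * k" by (metis dvd_div_mult_self)
    have "k dvd m * k - s * k" by simp
    then show ?thesis using assms unfolding i mult_gf_def
      by (auto simp: fps_X_power_mult_nth not_less)
  next
    case False
    have "\<not> k dvd i - s * k" if "s * k \<le> i"
      using False that by (metis dvd_diffD dvd_triv_right)
    then show ?thesis using False by (auto simp: mult_gf_def fps_X_power_mult_nth not_less)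
  qed
qed

lemma mult_gf_add: "mult_gf k (\<lambda>m. a m + b m) = mult_gf k a + (mult_gf k b :: 'a::comm_ring_1 fps)"
  by (rule fps_ext) (simp add: mult_gf_def)

lemma mult_gf_diff: "mult_gf k (\<lambda>m. a m - b m) = mult_gf k a - (mult_gf k b :: 'a::comm_ring_1 fps)"
  by (rule fps_ext) (simp add: mult_gf_def)

lemma mult_gf_cmult: "mult_gf k (\<lambda>m. c * a m) = fps_const c * (mult_gf k a :: 'a::comm_ring_1 fps)"
  by (rule fps_ext) (simp add: mult_gf_def)

lemmas mult_gf_simps = mult_gf_add mult_gf_diff mult_gf_cmult mult_gf_tail

section \<open>The identity between the marked products\<close>

text \<open>The identity of the three totals, with the common factor \<open>1 / (1 - X^k)\<close> for each \<open>k\<close> in \<open>K\<close>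
  removed. It is exact for finite products because of the asymmetric truncation: the index set
  \<open>{1..r * n}\<close> contains the multiple \<open>r * k\<close> for each \<open>k \<le> n\<close>, while the \<open>D\<close> factors with \<open>k > n\<close>
  carry no \<open>Z\<close>. Hence the unmarked cofactors on either side multiply to
  \<open>\<Prod>k=1..n. 1 + (Z - 1) * X ^ (r * k)\<close>. Dropping \<open>Z\<close> for \<open>k > n\<close> does not change the
  coefficient at \<open>X ^ n\<close>, as a partition of \<open>n\<close> has no part above \<open>n\<close>.\<close>

lemma marked_products_identity:
  fixes Z X :: "'a::comm_ring_1" and n r :: nat
  defines "K \<equiv> {1..r * n}"
  defines "uD \<equiv> (\<lambda>k. if k \<le> n then 1 + (Z - 1) * X ^ (r * k) else 1)"
    and "uO \<equiv> (\<lambda>k. if r dvd k then 1 + (Z - 1) * X ^ k else 1)"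
  assumes r: "0 < r"
  shows "Z * ((\<Sum>k\<in>K. (if k \<le> n then X ^ k + (Z - 1) * X ^ (r * k) else X ^ k) * (\<Prod>i\<in>K - {k}. uD i)) -
      (\<Sum>k\<in>K. (if r dvd k then Z * X ^ k else X ^ k) * (\<Prod>i\<in>K - {k}. uO i))) =
    (1 - Z) * (\<Sum>k\<in>K. (if k \<le> n then Z * (X ^ ((r + 1) * k) - X ^ (2 * r * k)) else 0) *
      (\<Prod>i\<in>K - {k}. uD i))"
proof -
  let ?A = "{1..n}"
  define y where "y = (\<lambda>k. 1 + (Z - 1) * X ^ (r * k))"
  define F where "F = (\<Prod>k\<in>?A. y k)"
  define L where "L = (\<lambda>k. \<Prod>i\<in>?A - {k}. y i)"
  have finK: "finite K" by (simp add: K_def)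
  have A: "{k\<in>K. k \<le> n} = ?A"
    using r by (auto simp: K_def intro: order_trans)
  have M: "{k\<in>K. r dvd k} = (*) r ` ?A"
    using r by (auto simp: K_def elim!: dvdE)
  have inj: "inj_on ((*) r) B" for B using r by (simp add: inj_on_def)
  have F: "F = y k * L k" if "k \<in> ?A" for k
    using that by (simp add: F_def L_def prod.remove)
  have pD: "(\<Prod>i\<in>K - {k}. uD i) = (\<Prod>i\<in>?A - {k}. y i)" for k
    using finK unfolding A[symmetric]
    by (intro prod.mono_neutral_cong_right) (auto simp: uD_def y_def)
  have uO_mult: "(\<Prod>i\<in>K - {k}. uO i) = (\<Prod>i\<in>(*) r ` ?A - {k}. uO i)" for k
    using finK unfolding M[symmetric]
    by (intro prod.mono_neutral_cong_right) (auto simp: uO_def)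
  have image: "(*) r ` ?A - {r * a} = (*) r ` (?A - {a})" for a
    using r by auto
  have uO_image: "(\<Prod>i\<in>(*) r ` B. uO i) = (\<Prod>i\<in>B. y i)" for B
    by (subst prod.reindex[OF inj]) (simp add: uO_def y_def)
  have pO: "(\<Prod>i\<in>K - {r * a}. uO i) = L a" for a
    by (simp only: uO_mult image uO_image L_def)
  have pO': "(\<Prod>i\<in>K - {k}. uO i) = F" if "\<not> r dvd k" for k
  proof -
    have "(*) r ` ?A - {k} = (*) r ` ?A" using that by auto
    then show ?thesis by (simp only: uO_mult uO_image F_def)
  qed
  have split: "(\<Sum>k\<in>K. f k) = (\<Sum>k\<in>?A. f k) + (\<Sum>k\<in>{k\<in>K. \<not> k \<le> n}. f k)"
    "(\<Sum>k\<in>K. f k) = (\<Sum>k\<in>?A. f (r * k)) + (\<Sum>k\<in>{k\<in>K. \<not> r dvd k}. f k)" for f :: "nat \<Rightarrow> 'a"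
  proof -
    have *: "(\<Sum>k\<in>K. f k) = (\<Sum>k\<in>{k\<in>K. P k}. f k) + (\<Sum>k\<in>{k\<in>K. \<not> P k}. f k)" for P
      using finK by (subst sum.union_disjoint[symmetric]) (auto intro: sum.cong)
    from *[of "\<lambda>k. k \<le> n"] show "(\<Sum>k\<in>K. f k) = (\<Sum>k\<in>?A. f k) + (\<Sum>k\<in>{k\<in>K. \<not> k \<le> n}. f k)"
      unfolding A .
    from *[of "\<lambda>k. r dvd k"]
    show "(\<Sum>k\<in>K. f k) = (\<Sum>k\<in>?A. f (r * k)) + (\<Sum>k\<in>{k\<in>K. \<not> r dvd k}. f k)"
      unfolding M sum.reindex[OF inj] by simp
  qed
  have D: "(\<Sum>k\<in>K. (if k \<le> n then X ^ k + (Z - 1) * X ^ (r * k) else X ^ k) * (\<Prod>i\<in>K - {k}. uD i)) =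
      (\<Sum>k\<in>?A. (X ^ k + (Z - 1) * X ^ (r * k)) * L k) + (\<Sum>k\<in>{k\<in>K. \<not> k \<le> n}. X ^ k * F)"
    unfolding split(1) pD by (intro arg_cong2[of _ _ _ _ "(+)"] sum.cong) (auto simp: L_def F_def)
  have O: "(\<Sum>k\<in>K. (if r dvd k then Z * X ^ k else X ^ k) * (\<Prod>i\<in>K - {k}. uO i)) =
      (\<Sum>k\<in>?A. Z * X ^ (r * k) * L k) + (\<Sum>k\<in>{k\<in>K. \<not> r dvd k}. X ^ k * F)"
    unfolding split(2) by (intro arg_cong2[of _ _ _ _ "(+)"] sum.cong) (auto simp: pO pO')
  have T: "(\<Sum>k\<in>K. (if k \<le> n then Z * (X ^ ((r + 1) * k) - X ^ (2 * r * k)) else 0) *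
      (\<Prod>i\<in>K - {k}. uD i)) = (\<Sum>k\<in>?A. Z * (X ^ ((r + 1) * k) - X ^ (2 * r * k)) * L k)"
    unfolding split(1) pD by (simp add: L_def)
  \<comment> \<open>Both sums run over \<open>K\<close> with \<open>n\<close> indices removed: \<open>1..n\<close> in the first, their multiples by
    \<open>r\<close> in the second.\<close>
  have cancel: "(\<Sum>k\<in>{k\<in>K. \<not> k \<le> n}. X ^ k * F) - (\<Sum>k\<in>{k\<in>K. \<not> r dvd k}. X ^ k * F) =
      (\<Sum>k\<in>?A. (X ^ (r * k) - X ^ k) * F)"
    using split[of "\<lambda>k. X ^ k * F"] by (simp add: left_diff_distrib sum_subtractf algebra_simps)
  have "Z * ((X ^ k + (Z - 1) * X ^ (r * k)) * L k - Z * X ^ (r * k) * L k + (X ^ (r * k) - X ^ k) * F) =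
      (1 - Z) * (Z * (X ^ ((r + 1) * k) - X ^ (2 * r * k)) * L k)" if "k \<in> ?A" for k
  proof -
    have "X ^ ((r + 1) * k) = X ^ k * X ^ (r * k)" "X ^ (2 * r * k) = X ^ (r * k) * X ^ (r * k)"
      by (simp_all only: power_add[symmetric] mult_2 distrib_right add.commute mult_1_left)
    then show ?thesis unfolding F[OF that] y_def by (simp add: algebra_simps)
  qed
  then have "(\<Sum>k\<in>?A. Z * ((X ^ k + (Z - 1) * X ^ (r * k)) * L k - Z * X ^ (r * k) * L k +
      (X ^ (r * k) - X ^ k) * F)) =
      (\<Sum>k\<in>?A. (1 - Z) * (Z * (X ^ ((r + 1) * k) - X ^ (2 * r * k)) * L k))"
    by (rule sum.cong[OF refl])
  then show ?thesis
    unfolding D O T sum_distrib_left[symmetric] sum.distrib sum_subtractf cancel[symmetric]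
    by (simp add: algebra_simps)
qed

section \<open>Extraction of coefficients\<close>

lemma prod_if_eq_power_card:
  assumes "finite K"
  shows "(\<Prod>k\<in>K. if P k then z else 1) = (z :: 'a::comm_monoid_mult) ^ card {k\<in>K. P k}"
  using prod.inter_filter[OF assms, of "\<lambda>_. z" P] by simp

text \<open>A refined total \<open>\<Sum>p. f p * Z ^ d p\<close> encodes the totals over all level sets of \<open>d\<close> at once;
  for \<open>d\<close> the number of repeated or divisible part values these level sets are \<open>D_set\<close> and
  \<open>O_set\<close>.\<close>

lemma coeff_sum_of_nat_mult_monom:
  fixes f d :: "'b \<Rightarrow> nat"
  assumes "finite S"
  shows "coeff (\<Sum>p\<in>S. of_nat (f p) * monom 1 1 ^ d p) j = int (\<Sum>p\<in>{p\<in>S. d p = j}. f p)"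
proof -
  have "coeff (of_nat (f p) * monom (1::int) 1 ^ d p) j = (if d p = j then int (f p) else 0)" for p
    by (simp add: monom_power of_nat_mult_conv_smult)
  then show ?thesis
    using assms by (auto simp: coeff_sum sum.inter_filter intro!: sum.cong)
qed

theorem theorem6:
  fixes n j r :: nat
  assumes "r \<ge> 2"
  shows "b' j r n = int (T_num (j + 1) r n) - int (T_num j r n)"
proof -
  define K where "K = {1..r * n}"
  define z :: "int poly" where "z = monom 1 1"
  define wD where "wD = (\<lambda>k m::nat. if k \<le> n \<and> r \<le> m then z else 1)"
  define wO where "wO = (\<lambda>k m::nat. if r dvd k \<and> 1 \<le> m then z else 1)"
  define diff :: "nat \<Rightarrow> nat \<Rightarrow> int poly" where "diff = (\<lambda>k m. of_bool (1 \<le> m))"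
  define mid :: "nat \<Rightarrow> nat \<Rightarrow> int poly"
    where "mid = (\<lambda>k m. of_bool (k \<le> n \<and> r + 1 \<le> m \<and> m \<le> 2 * r - 1))"
  let ?Z = "fps_const z" and ?X = "fps_X :: int poly fps"
  let ?D = "\<lambda>p. card {k \<in> set_mset p. r \<le> count p k}"
  let ?O = "\<lambda>p. card {k \<in> set_mset p. r dvd k}"
  let ?T = "\<lambda>p. card {k \<in> set_mset p. r + 1 \<le> count p k \<and> count p k \<le> 2 * r - 1}"
  let ?uD = "\<lambda>k. if k \<le> n then 1 + (?Z - 1) * ?X ^ (r * k) else 1"
  let ?uO = "\<lambda>k. if r dvd k then 1 + (?Z - 1) * ?X ^ k else 1"
  let ?P = "\<Prod>k\<in>K. geom k :: int poly fps"
  have K: "finite K" "0 \<notin> K" by (auto simp: K_def)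
  have "n \<le> r * n" using assms by simp
  then have KP: "partitions_in K n = partitions n"
    by (intro partitions_in_eq_partitions) (auto simp: K_def)
  have pos: "0 < k" if "k \<in> K" for k using that by (simp add: K_def)

  \<comment> \<open>The weights and marks multiply and add up to the intended statistics.\<close>
  have supp: "set_mset p \<subseteq> K \<and> (\<forall>k\<in>#p. k \<le> n)" if "p \<in> partitions n" for p
  proof -
    have "p \<in> partitions_in {1..n} n" using that by (simp add: partitions_in_eq_partitions)
    then show ?thesis using that unfolding KP[symmetric] by (auto simp: partitions_in_def)
  qed
  have D_stat: "(\<Prod>k\<in>K. wD k (count p k)) = z ^ ?D p" if "p \<in> partitions n" for p
  proof -
    have "{k\<in>K. k \<le> n \<and> r \<le> count p k} = {k \<in> set_mset p. r \<le> count p k}"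
      using supp[OF that] assms by (auto simp flip: count_greater_zero_iff)
    then show ?thesis using K by (simp add: wD_def prod_if_eq_power_card)
  qed
  have O_stat: "(\<Prod>k\<in>K. wO k (count p k)) = z ^ ?O p" if "p \<in> partitions n" for p
  proof -
    have "{k\<in>K. r dvd k \<and> 1 \<le> count p k} = {k \<in> set_mset p. r dvd k}"
      using supp[OF that] by auto
    then show ?thesis using K by (simp only: wO_def prod_if_eq_power_card)
  qed
  have diff_stat: "(\<Sum>k\<in>K. diff k (count p k)) = of_nat (num_diff_parts p)" if "p \<in> partitions n" for p
  proof -
    have "K \<inter> {k. 1 \<le> count p k} = set_mset p" using supp[OF that] by auto
    then show ?thesis using K by (simp only: diff_def sum_of_bool_eq num_diff_parts_def)
  qed
  have mid_stat: "(\<Sum>k\<in>K. mid k (count p k)) = of_nat (?T p)" if "p \<in> partitions n" for p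
  proof -
    have "K \<inter> {k. k \<le> n \<and> r + 1 \<le> count p k \<and> count p k \<le> 2 * r - 1} =
        {k \<in> set_mset p. r + 1 \<le> count p k \<and> count p k \<le> 2 * r - 1}"
      using supp[OF that] by (auto simp flip: count_greater_zero_iff)
    then show ?thesis using K by (simp only: mid_def sum_of_bool_eq)
  qed

  \<comment> \<open>Each plain or marked weight as a combination of tail indicators, and the resulting cofactor.\<close>
  have wD: "mult_gf k (wD k) = ?uD k * geom k" if "k \<in> K" for k
  proof -
    have "wD k = (\<lambda>m. if k \<le> n then 1 + (z - 1) * of_bool (r \<le> m) else 1)"
      by (auto simp: wD_def)
    then show ?thesis using pos[OF that] by (simp add: mult_gf_simps algebra_simps flip: fps_const_sub)
  qed
  have wO: "mult_gf k (wO k) = ?uO k * geom k" if "k \<in> K" for k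
  proof -
    have "wO k = (\<lambda>m. if r dvd k then 1 + (z - 1) * of_bool (1 \<le> m) else 1)"
      by (auto simp: wO_def)
    then show ?thesis using pos[OF that]
      by (simp add: mult_gf_simps algebra_simps del: One_nat_def flip: fps_const_sub)
  qed
  have D: "mult_gf k (\<lambda>m. diff k m * wD k m) =
      (if k \<le> n then ?X ^ k + (?Z - 1) * ?X ^ (r * k) else ?X ^ k) * geom k" if "k \<in> K" for k
  proof -
    have "(\<lambda>m. diff k m * wD k m) =
        (\<lambda>m. if k \<le> n then of_bool (1 \<le> m) + (z - 1) * of_bool (r \<le> m) else of_bool (1 \<le> m))"
      using assms by (auto simp: wD_def diff_def)
    then show ?thesis using pos[OF that]
      by (simp add: mult_gf_simps algebra_simps del: One_nat_def flip: fps_const_sub)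
  qed
  have O: "mult_gf k (\<lambda>m. diff k m * wO k m) =
      (if r dvd k then ?Z * ?X ^ k else ?X ^ k) * geom k" if "k \<in> K" for k
  proof -
    have "(\<lambda>m. diff k m * wO k m) =
        (\<lambda>m. if r dvd k then z * of_bool (1 \<le> m) else of_bool (1 \<le> m))"
      by (auto simp: wO_def diff_def)
    then show ?thesis using pos[OF that]
      by (simp add: mult_gf_simps algebra_simps del: One_nat_def)
  qed
  have T: "mult_gf k (\<lambda>m. mid k m * wD k m) =
      (if k \<le> n then ?Z * (?X ^ ((r + 1) * k) - ?X ^ (2 * r * k)) else 0) * geom k"
    if "k \<in> K" for k
  proof -
    have "(\<lambda>m. mid k m * wD k m) =
        (\<lambda>m. if k \<le> n then z * (of_bool (r + 1 \<le> m) - of_bool (2 * r \<le> m)) else 0)"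
      using assms by (intro ext) (auto simp: wD_def mid_def)
    moreover have "mult_gf k (\<lambda>_. 0 :: int poly) = 0"
      by (rule fps_ext) (simp add: mult_gf_def)
    moreover have "mult_gf k (\<lambda>m. z * (of_bool (r + 1 \<le> m) - of_bool (2 * r \<le> m))) =
        ?Z * (?X ^ ((r + 1) * k) - ?X ^ (2 * r * k)) * geom k"
      using pos[OF that] by (simp only: mult_gf_simps) (simp only: left_diff_distrib mult.assoc)
    ultimately show ?thesis by (simp split: if_splits)
  qed

  \<comment> \<open>The three totals, refined by \<open>z\<close>, are the coefficients at \<open>X ^ n\<close> of the marked products.\<close>
  let ?SD = "\<Sum>p\<in>partitions n. of_nat (num_diff_parts p) * z ^ ?D p"
  let ?SO = "\<Sum>p\<in>partitions n. of_nat (num_diff_parts p) * z ^ ?O p"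
  let ?ST = "\<Sum>p\<in>partitions n. of_nat (?T p) * z ^ ?D p"
  have SD: "?SD = fps_nth ((\<Sum>k\<in>K. (if k \<le> n then ?X ^ k + (?Z - 1) * ?X ^ (r * k) else ?X ^ k) *
      (\<Prod>i\<in>K - {k}. ?uD i)) * ?P) n"
    using sum_marked_multiplicities[OF K wD D, of n] by (simp add: KP D_stat diff_stat)
  have SO: "?SO = fps_nth ((\<Sum>k\<in>K. (if r dvd k then ?Z * ?X ^ k else ?X ^ k) *
      (\<Prod>i\<in>K - {k}. ?uO i)) * ?P) n"
    using sum_marked_multiplicities[OF K wO O, of n] by (simp add: KP O_stat diff_stat)
  have ST: "?ST = fps_nth ((\<Sum>k\<in>K. (if k \<le> n then ?Z * (?X ^ ((r + 1) * k) - ?X ^ (2 * r * k)) else 0) *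
      (\<Prod>i\<in>K - {k}. ?uD i)) * ?P) n"
    using sum_marked_multiplicities[OF K wD T, of n] by (simp add: KP D_stat mid_stat)
  have r: "0 < r" using assms by simp
  have "z * (?SD - ?SO) = (1 - z) * ?ST"
    using arg_cong[OF marked_products_identity[OF r, where Z = ?Z and X = ?X and n = n, folded K_def], of "\<lambda>f. fps_nth (f * ?P) n"]
    unfolding SD SO ST
    by (simp only: left_diff_distrib right_diff_distrib mult.assoc fps_sub_nth fps_mult_left_const_nth
        mult_1_left)
  then have eq: "coeff (z * (?SD - ?SO)) (Suc j) = coeff (?ST - z * ?ST) (Suc j)"
    by (simp add: left_diff_distrib)
  have shift: "coeff (z * q) (Suc j) = coeff q j" for q
    by (simp add: z_def monom_Suc monom_0)
  have "coeff ?SD j - coeff ?SO j = coeff ?ST (Suc j) - coeff ?ST j"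
    using eq by (simp only: shift coeff_diff)
  then show ?thesis
    unfolding z_def coeff_sum_of_nat_mult_monom[OF finite_partitions]
    by (simp add: b'_def T_num_def D_set_def O_set_def)
qed

end
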